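(* Let $p\equiv 1\pmod 4$ be a prime and $t=\prod_{x=1}^{(p-1)/2}x$. Let $\gamma(t,p)$ be the number of pairs $(i,j)$ with $1\le i<j\le (p-1)/2$ and $\widetilde{ti}>\widetilde{tj}$. Let $X=\{(a,b)\in V\times V : a<b<\overline{a}<\overline{b}\}$ and $Z=\{(a,b)\in V\times V : a<b<\overline{b}<\overline{a}\}$. Then $\gamma(t,p)=4|Z|+2|X|+(p-1)/4$.
   Context: For an integer $x$, $\{x\}_p$ denotes the least nonnegative residue of $x$ modulo $p$, and $\widetilde{x}=p-\{x\}_p$ if $\{x\}_p>p/2$, while $\widetilde{x}=\{x\}_p$ if $\{x\}_p<p/2$. Let $V=\{x : 1\le x\le (p-1)/2,\ x<\widetilde{tx}\}$, and for $a\in V$ put $\overline{a}=\widetilde{ta}$. *)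

theory Defs
  imports "HOL-Number_Theory.Number_Theory"
begin

text \<open>For odd \<open>p\<close> the tie \<open>2 * (x mod p) = p\<close> cannot occur.\<close>

definition tilde :: "int \<Rightarrow> int \<Rightarrow> int" where
  "tilde p x = (if 2 * (x mod p) > p then p - x mod p else x mod p)"

definition setV :: "int \<Rightarrow> int \<Rightarrow> int set" where
  "setV t p = {x. 1 \<le> x \<and> x \<le> (p - 1) div 2 \<and> x < tilde p (t * x)}"

definition bar :: "int \<Rightarrow> int \<Rightarrow> int \<Rightarrow> int" where
  "bar t p a = tilde p (t * a)"

definition inversions :: "int \<Rightarrow> int \<Rightarrow> nat" where
  "inversions t p =
     card {(i, j). 1 \<le> i \<and> i < j \<and> j \<le> (p - 1) div 2 \<and> tilde p (t * i) > tilde p (t * j)}"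

definition setX :: "int \<Rightarrow> int \<Rightarrow> (int \<times> int) set" where
  "setX t p = {(a, b) \<in> setV t p \<times> setV t p. a < b \<and> b < bar t p a \<and> bar t p a < bar t p b}"

definition setZ :: "int \<Rightarrow> int \<Rightarrow> (int \<times> int) set" where
  "setZ t p = {(a, b) \<in> setV t p \<times> setV t p. a < b \<and> b < bar t p b \<and> bar t p b < bar t p a}"

end

theory Submission
  imports Defs
begin

text \<open>
  By Wilson's theorem \<open>t\<^sup>2 \<equiv> -1\<close> modulo \<open>p\<close>, so \<open>x \<mapsto> tilde p (t * x)\<close> is an involution without
  fixed points on \<open>{1..(p - 1) div 2}\<close>. It pairs this set off into \<open>(p - 1) div 4\<close> arcs
  \<open>(a, bar t p a)\<close> with \<open>a \<in> setV t p\<close>. Each arc is itself an inversion; two crossing arcs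
  contribute two further inversions, two nested arcs contribute four, and two separated arcs none.
\<close>

section \<open>Inversions of a fixed-point-free involution\<close>

text \<open>Isolates the combinatorics: on a finite linearly ordered set the inversion count depends
  only on how the arcs joining \<open>x\<close> to \<open>f x\<close> lie relative to each
  other.\<close>

locale free_involution =
  fixes S :: "'a::linorder set" and f :: "'a \<Rightarrow> 'a"
  assumes finite_S: "finite S"
    and maps: "x \<in> S \<Longrightarrow> f x \<in> S"
    and invol: "x \<in> S \<Longrightarrow> f (f x) = x"
    and no_fix: "x \<in> S \<Longrightarrow> f x \<noteq> x"
begin

definition openers :: "'a set" where
  "openers = {x \<in> S. x < f x}"

definition nested :: "('a \<times> 'a) set" where
  "nested = {(a, b) \<in> openers \<times> openers. a < b \<and> b < f b \<and> f b < f a}"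

definition crossing :: "('a \<times> 'a) set" where
  "crossing = {(a, b) \<in> openers \<times> openers. a < b \<and> b < f a \<and> f a < f b}"

text \<open>Nested and crossing pairs of arcs together: both kinds yield the inversions
  \<open>(a, f b)\<close> and \<open>(b, f a)\<close>.\<close>

definition overlapping :: "('a \<times> 'a) set" where
  "overlapping = {(a, b) \<in> openers \<times> openers. a < b \<and> b < f a}"

definition inverted :: "('a \<times> 'a) set" where
  "inverted = {(i, j) \<in> S \<times> S. i < j \<and> f j < f i}"

lemma eq_iff: "x \<in> S \<Longrightarrow> y \<in> S \<Longrightarrow> f x = f y \<longleftrightarrow> x = y"
  using invol by metis

lemma finite_openers: "finite openers"
  using finite_S by (simp add: openers_def)

lemma finite_pairs: "finite nested" "finite crossing" "finite overlapping"
  by (rule finite_subset[of _ "openers \<times> openers"];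
      force simp: nested_def crossing_def overlapping_def finite_openers)+

text \<open>Each orbit of \<open>f\<close> has two elements, and exactly the smaller one is an
  opener.\<close>

lemma card_openers: "card S = 2 * card openers"
proof -
  have "S = openers \<union> f ` openers"
  proof
    show "S \<subseteq> openers \<union> f ` openers"
    proof
      fix x assume x: "x \<in> S"
      show "x \<in> openers \<union> f ` openers"
      proof (cases "x < f x")
        case True
        with x show ?thesis by (simp add: openers_def)
      next
        case False
        then have "f x \<in> openers"
          using x maps[OF x] invol[OF x] no_fix[OF x] by (auto simp: openers_def)
        then show ?thesis using invol[OF x] by (metis UnI2 imageI)
      qed
    qed
  qed (auto simp: openers_def maps)
  moreover have "openers \<inter> f ` openers = {}"
    by (auto simp: openers_def invol)
  moreover have "card (f ` openers) = card openers"
    by (rule card_image) (auto simp: inj_on_def openers_def eq_iff)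
  ultimately show ?thesis
    using finite_openers by (metis card_Un_disjoint finite_imageI mult_2)
qed

text \<open>Overlapping arcs have distinct right ends, whose order decides between nested and
  crossing.\<close>

lemma card_overlapping: "card overlapping = card nested + card crossing"
proof -
  have "overlapping = nested \<union> crossing"
  proof
    show "overlapping \<subseteq> nested \<union> crossing"
    proof
      fix x assume "x \<in> overlapping"
      then obtain a b where x: "x = (a, b)" and ab: "a \<in> openers" "b \<in> openers" "a < b" "b < f a"
        by (auto simp: overlapping_def)
      then have "f a \<noteq> f b" using eq_iff by (auto simp: openers_def)
      with ab show "x \<in> nested \<union> crossing"
        by (auto simp: x nested_def crossing_def openers_def)
    qed
  qed (auto simp: overlapping_def nested_def crossing_def)
  moreover have "nested \<inter> crossing = {}"
    by (auto simp: nested_def crossing_def)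
  ultimately show ?thesis using finite_pairs by (simp add: card_Un_disjoint)
qed

text \<open>Inversions \<open>(i, j)\<close> are sorted by whether \<open>i\<close> and
  \<open>j\<close> are left or right ends of their arcs. Two left ends or two right ends give nested
  arcs; a left end \<open>i\<close> and a right end \<open>j\<close> give a single arc or two
  overlapping ones.\<close>

lemma inverted_decomposition:
  "inverted = nested \<union> (\<lambda>(a, b). (f b, f a)) ` nested \<union> (\<lambda>a. (a, f a)) ` openers
     \<union> (\<lambda>(a, b). (a, f b)) ` overlapping \<union> (\<lambda>(a, b). (b, f a)) ` overlapping"
  (is "_ = ?N \<union> ?N' \<union> ?A \<union> ?O \<union> ?O'")
proof
  show "inverted \<subseteq> ?N \<union> ?N' \<union> ?A \<union> ?O \<union> ?O'"
  proof
    fix x assume "x \<in> inverted"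
    then obtain i j where x: "x = (i, j)" and S: "i \<in> S" "j \<in> S" and ij: "i < j" "f j < f i"
      by (auto simp: inverted_def)
    have closer: "f k \<in> openers" if "k \<in> S" "\<not> k < f k" for k
      using that maps[of k] invol[of k] no_fix[of k] by (auto simp: openers_def)
    \<comment> \<open>A right end \<open>i\<close> with a left end \<open>j\<close> would give
      \<open>f i \<le> i < j < f j\<close>, against \<open>f j < f i\<close>.\<close>
    consider "i < f i" "j < f j" | "\<not> i < f i" "\<not> j < f j" | "i < f i" "\<not> j < f j"
      using ij by fastforce
    then show "x \<in> ?N \<union> ?N' \<union> ?A \<union> ?O \<union> ?O'"
    proof cases
      case 1
      then have "x \<in> ?N" using S ij by (auto simp: x nested_def openers_def)
      then show ?thesis by blast
    next
      case 2
      then have "(f j, f i) \<in> nested"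
        using S ij closer[of i] closer[of j] invol by (auto simp: nested_def openers_def)
      then have "x \<in> ?N'" using S invol[of i] invol[of j] by (force simp: x)
      then show ?thesis by blast
    next
      case 3
      then have i: "i \<in> openers" and j: "f j \<in> openers"
        using S closer by (auto simp: openers_def)
      \<comment> \<open>The arcs through \<open>i\<close> and \<open>j\<close> have left ends
        \<open>i\<close> and \<open>f j\<close>.\<close>
      consider "i = f j" | "i < f j" | "f j < i" by fastforce
      then show ?thesis
      proof cases
        case 1
        then have "x \<in> ?A" using i S invol[of j] by (force simp: x)
        then show ?thesis by blast
      next
        case 2
        then have "(i, f j) \<in> overlapping" using i j ij by (auto simp: overlapping_def)
        then have "x \<in> ?O" using S invol[of j] by (force simp: x)
        then show ?thesis by blast
      next
        case 3
        then have "(f j, i) \<in> overlapping"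
          using i j ij S invol[of j] by (auto simp: overlapping_def)
        then have "x \<in> ?O'" using S invol[of j] by (force simp: x)
        then show ?thesis by blast
      qed
    qed
  qed
  show "?N \<union> ?N' \<union> ?A \<union> ?O \<union> ?O' \<subseteq> inverted"
    by (auto simp: inverted_def nested_def openers_def overlapping_def maps invol)
qed

text \<open>The five pieces are disjoint and injectively parametrized. A nested pair enters four of
  them, a crossing pair only the two indexed by \<open>overlapping\<close>, and each arc enters
  \<open>?A\<close> once.\<close>

theorem card_inverted: "card inverted = 4 * card nested + 2 * card crossing + card openers"
proof -
  let ?N' = "(\<lambda>(a, b). (f b, f a)) ` nested" and ?A = "(\<lambda>a. (a, f a)) ` openers"
    and ?O = "(\<lambda>(a, b). (a, f b)) ` overlapping" and ?O' = "(\<lambda>(a, b). (b, f a)) ` overlapping"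
  have "card ?N' = card nested" "card ?O = card overlapping" "card ?O' = card overlapping"
    by (rule card_image; auto simp: inj_on_def nested_def overlapping_def openers_def eq_iff)+
  moreover have "card ?A = card openers"
    by (rule card_image) (auto simp: inj_on_def)
  moreover have "nested \<inter> ?N' = {}"
    by (auto simp: nested_def openers_def invol)
  moreover have "(nested \<union> ?N') \<inter> ?A = {}"
    by (auto simp: nested_def openers_def invol)
  moreover have "(nested \<union> ?N' \<union> ?A) \<inter> ?O = {}"
    by (auto simp: nested_def overlapping_def openers_def invol eq_iff)
  \<comment> \<open>Both \<open>?O\<close> and \<open>?O'\<close> pair a left end with a right end
    of another arc; the left end belongs to the arc opening first in \<open>?O\<close>, second in
    \<open>?O'\<close>.\<close>
  moreover have "(nested \<union> ?N' \<union> ?A \<union> ?O) \<inter> ?O' = {}"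
    by (auto simp: nested_def overlapping_def openers_def invol eq_iff)
  ultimately have "card inverted = 2 * card nested + card openers + 2 * card overlapping"
    unfolding inverted_decomposition
    using finite_pairs finite_openers by (simp add: card_Un_disjoint)
  then show ?thesis by (simp add: card_overlapping)
qed

end

section \<open>Absolute least residues\<close>

lemma tilde_bounds:
  assumes "p > 0" "odd p"
  shows "0 \<le> tilde p x" "tilde p x \<le> (p - 1) div 2"
proof -
  obtain m where "p = 2 * m + 1" using assms(2) by (elim oddE)
  moreover have "0 \<le> x mod p" "x mod p < p" using assms(1) by simp_all
  ultimately show "0 \<le> tilde p x" "tilde p x \<le> (p - 1) div 2"
    by (simp_all add: tilde_def)
qed

lemma tilde_cong: "p dvd tilde p x - x \<or> p dvd tilde p x + x"
proof (cases "2 * (x mod p) > p")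
  case True
  have "p - x mod p + x = p + p * (x div p)"
    using mult_div_mod_eq[of p x] by linarith
  then have "p dvd p - x mod p + x" by (metis dvd_add dvd_refl dvd_triv_left)
  with True show ?thesis by (simp add: tilde_def)
next
  case False
  have "x mod p - x = - (p * (x div p))"
    using mult_div_mod_eq[of p x] by linarith
  then have "p dvd x mod p - x" by (metis dvd_minus_iff dvd_triv_left)
  with False show ?thesis by (simp add: tilde_def)
qed

text \<open>Two numbers in the half range that agree with \<open>x\<close> up to sign modulo
  \<open>p\<close> have difference or sum divisible by \<open>p\<close>. Both are below
  \<open>p\<close> in absolute value, so the divisible one is 0; a zero sum makes both numbers
  0.\<close>

lemma tilde_unique:
  assumes "p > 0" "odd p" "0 \<le> y" "y \<le> (p - 1) div 2" "p dvd y - x \<or> p dvd y + x"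
  shows "tilde p x = y"
proof -
  let ?z = "tilde p x"
  have "p dvd ?z - y \<or> p dvd ?z + y"
    using tilde_cong[of p x] assms(5)
    by (smt (verit) dvd_add dvd_diff dvd_minus_iff)
  moreover have "\<bar>?z - y\<bar> < p" "0 \<le> ?z + y" "?z + y < p"
    using tilde_bounds[OF assms(1,2), of x] assms(1-4) by (auto elim!: oddE)
  ultimately show ?thesis
    using tilde_bounds[OF assms(1,2), of x] assms(3)
    by (smt (verit) zdvd_imp_le dvd_minus_iff)
qed

section \<open>The half factorial as a square root of -1, and the involution it induces\<close>

text \<open>Reflection \<open>x\<close> to \<open>p - x\<close> carries the lower half to the upper
  half, so the product in Wilson's theorem is the square of the half product up to the sign
  \<open>(-1)^m\<close>.\<close>

lemma half_factorial_square_cong: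
  fixes p :: int
  assumes "prime p" "[p = 1] (mod 4)"
  shows "[(\<Prod>x = 1..(p - 1) div 2. x)\<^sup>2 = - 1] (mod p)"
proof -
  define m where "m = (p - 1) div 2"
  have "p > 1" using assms(1) by (simp add: prime_gt_1_int)
  have "4 dvd p - 1" using assms(2) by (simp add: cong_iff_dvd_diff)
  then obtain k where k: "p - 1 = 4 * k" by (elim dvdE)
  have p: "p = 2 * m + 1" and m: "m \<ge> 0" "even (nat m)"
    using k \<open>p > 1\<close> by (auto simp: m_def even_nat_iff)
  have "(\<Prod>x = m + 1..p - 1. x) = (\<Prod>x = 1..m. p - x)"
    by (rule prod.reindex_bij_witness[of _ "\<lambda>x. p - x" "\<lambda>x. p - x"]) (auto simp: p)
  also have "[(\<Prod>x = 1..m. p - x) = (\<Prod>x = 1..m. (- 1) * x)] (mod p)"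
    by (rule cong_prod) (simp add: cong_iff_dvd_diff)
  \<comment> \<open>The sign is 1: from \<open>p - 1 = 4 * k\<close> it follows that
    \<open>m = 2 * k\<close> is even.\<close>
  also have "(\<Prod>x = 1..m. (- 1) * x) = (\<Prod>x = 1..m. x)"
    using m by (simp only: prod.distrib prod_constant) simp
  finally have upper: "[(\<Prod>x = m + 1..p - 1. x) = (\<Prod>x = 1..m. x)] (mod p)" .
  have "{1..p - 1} = {1..m} \<union> {m + 1..p - 1}" using m p by auto
  then have "(\<Prod>x = 1..p - 1. x) = (\<Prod>x = 1..m. x) * (\<Prod>x = m + 1..p - 1. x)"
    by (simp add: prod.union_disjoint)
  then have "[(\<Prod>x = 1..m. x)\<^sup>2 = (\<Prod>x = 1..p - 1. x)] (mod p)"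
    using cong_mult[OF cong_refl cong_sym[OF upper]] by (simp add: power2_eq_square)
  also have "(\<Prod>x = 1..p - 1. x) = fact (nat p - 1)"
  proof -
    have "(\<Prod>x = 1..p - 1. x) = (\<Prod>x = 1..nat p - 1. int x)"
      using \<open>p > 1\<close> by (intro prod.reindex_bij_witness[of _ int nat]) auto
    then show ?thesis by (simp add: fact_prod)
  qed
  also have "[fact (nat p - 1) = (- 1 :: int)] (mod p)"
    using wilson_theorem[of "nat p"] assms(1) \<open>p > 1\<close> by simp
  finally show ?thesis by (simp add: m_def)
qed

text \<open>Applying the map twice multiplies by \<open>t\<^sup>2\<close>, that is by -1 modulo
  \<open>p\<close>, up to a sign that \<open>tilde\<close> ignores. A fixed point would make
  \<open>t\<close> congruent to 1 or -1, hence \<open>p dvd 2\<close>.\<close>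

lemma free_involution_tilde:
  fixes p t :: int
  assumes "prime p" "odd p" "[t\<^sup>2 = - 1] (mod p)"
  shows "free_involution {1..(p - 1) div 2} (\<lambda>x. tilde p (t * x))"
proof
  have "p > 2" using assms(1,2) prime_ge_2_int[of p] by (cases "p = 2") auto
  then have "p > 0" by simp
  note bounds = tilde_bounds[OF \<open>p > 0\<close> assms(2)]
  have t2: "p dvd t\<^sup>2 + 1" using assms(3) by (simp add: cong_iff_dvd_diff)
  fix x assume "x \<in> {1..(p - 1) div 2}"
  then have x: "1 \<le> x" "x \<le> (p - 1) div 2" by auto
  then have "\<not> p dvd x" using \<open>p > 2\<close> zdvd_imp_le[of p x] by linarith
  have "\<not> p dvd t"
  proof
    assume "p dvd t"
    then have "p dvd t\<^sup>2" by (simp add: power2_eq_square)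
    with t2 have "p dvd 1" by (simp add: dvd_add_right_iff)
    then show False using \<open>p > 2\<close> by simp
  qed
  let ?y = "tilde p (t * x)"
  have "?y \<noteq> 0"
  proof
    assume "?y = 0"
    with tilde_cong[of p "t * x"] have "p dvd t * x" by simp
    with \<open>\<not> p dvd x\<close> \<open>\<not> p dvd t\<close> show False
      using assms(1) prime_dvd_mult_iff by blast
  qed
  with bounds[of "t * x"] show "?y \<in> {1..(p - 1) div 2}" by simp
  show "tilde p (t * ?y) = x"
  proof (rule tilde_unique[OF \<open>p > 0\<close> assms(2)])
    \<comment> \<open>This multiple of \<open>p\<close> cancels the term
      \<open>t\<^sup>2 * x\<close> that arises when the congruence for \<open>?y\<close> is
      multiplied by \<open>t\<close>.\<close>
    have t2x: "p dvd (t\<^sup>2 + 1) * x" using t2 by simp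
    from tilde_cong[of p "t * x"] show "p dvd x - t * ?y \<or> p dvd x + t * ?y"
    proof
      assume "p dvd ?y - t * x"
      then have "p dvd t * (?y - t * x) + (t\<^sup>2 + 1) * x" using t2x by simp
      also have "t * (?y - t * x) + (t\<^sup>2 + 1) * x = x + t * ?y"
        by (simp add: algebra_simps power2_eq_square)
      finally show ?thesis by simp
    next
      assume "p dvd ?y + t * x"
      then have "p dvd (t\<^sup>2 + 1) * x - t * (?y + t * x)" using t2x by simp
      also have "(t\<^sup>2 + 1) * x - t * (?y + t * x) = x - t * ?y"
        by (simp add: algebra_simps power2_eq_square)
      finally show ?thesis by simp
    qed
  qed (use x in auto)
  show "?y \<noteq> x"
  proof
    assume "?y = x"
    then have "p dvd (1 - t) * x \<or> p dvd (1 + t) * x"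
      using tilde_cong[of p "t * x"] by (simp add: algebra_simps)
    then have "p dvd 1 - t \<or> p dvd 1 + t"
      using \<open>\<not> p dvd x\<close> assms(1) prime_dvd_mult_iff by blast
    then have "p dvd (1 - t) * (1 + t)" by auto
    \<comment> \<open>The sum is \<open>1 - t\<^sup>2 + t\<^sup>2 + 1 = 2\<close>.\<close>
    then have "p dvd (1 - t) * (1 + t) + (t\<^sup>2 + 1)" using t2 by simp
    then have "p dvd 2" by (simp add: algebra_simps power2_eq_square)
    then show False using \<open>p > 2\<close> zdvd_imp_le[of p 2] by simp
  qed
qed simp

theorem theorem3p2:
  fixes p t :: int
  assumes "prime p" and "[p = 1] (mod 4)"
    and "t = (\<Prod>x = 1..(p - 1) div 2. x)"
  shows "int (inversions t p) = 4 * int (card (setZ t p)) + 2 * int (card (setX t p)) + (p - 1) div 4"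
proof -
  have "p > 1" using assms(1) by (simp add: prime_gt_1_int)
  have "4 dvd p - 1" using assms(2) by (simp add: cong_iff_dvd_diff)
  then obtain k where k: "p - 1 = 4 * k" by (elim dvdE)
  then have "odd p" by presburger
  interpret free_involution "{1..(p - 1) div 2}" "\<lambda>x. tilde p (t * x)"
    using free_involution_tilde[OF assms(1) \<open>odd p\<close>] half_factorial_square_cong[OF assms(1,2)]
    by (simp add: assms(3))
  have V: "setV t p = openers"
    by (auto simp: setV_def openers_def)
  have "inversions t p = card inverted"
    unfolding inversions_def inverted_def by (rule arg_cong[of _ _ card]) auto
  moreover have "setZ t p = nested" "setX t p = crossing"
    by (simp_all add: setZ_def nested_def setX_def crossing_def V bar_def)
  \<comment> \<open>The interval has \<open>2 * k\<close> elements, twice the number of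
    openers.\<close>
  moreover have "int (card openers) = (p - 1) div 4"
    using card_openers k \<open>p > 1\<close> by simp
  ultimately show ?thesis by (simp add: card_inverted)
qed

end
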